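(* Let $\alpha,\beta,\gamma,\delta\in\mathbb{C}$ with $\mathrm{Re}(\alpha),\mathrm{Re}(\beta)>0$, let $x,y\in\mathbb{C}$, and let $t\in\mathbb{C}$ with $|t|<1$. Then $$\sum_{n=0}^{\infty}\frac{(\delta)_n}{n!}L_n^{\alpha,\beta,\gamma}(x,y)\,t^n=(1-t)^{-\delta}E_{\alpha,\beta,\gamma}^{\delta}\left(\frac{-xt}{1-t},\frac{-yt}{1-t}\right).$$
   Context: For $\alpha,\beta,\gamma,\delta\in\mathbb{C}$ with $\mathrm{Re}(\alpha)>0$, $\mathrm{Re}(\beta)>0$ and $x,y\in\mathbb{C}$, the bivariate Mittag-Leffler function is $$E_{\alpha,\beta,\gamma}^{\delta}(x,y)=\sum_{k=0}^{\infty}\sum_{l=0}^{\infty}\frac{(\delta)_{k+l}}{\Gamma(\alpha k+\beta l+\gamma)}\cdot\frac{x^ky^l}{k!\,l!}$$ (the double series converges absolutely), where $(a)_n=a(a+1)\cdots(a+n-1)$, $(a)_0=1$, is the Pochhammer symbol, and $1/\Gamma$ is taken to be $0$ at the poles of $\Gamma$. For integers $n\ge0$ the bivariate Laguerre polynomials are $$L_n^{\alpha,\beta,\gamma}(x,y)=\sum_{l=0}^n\sum_{k=0}^{n-l}\frac{(-n)_{k+l}\,x^ky^l}{\Gamma(\alpha k+\beta l+\gamma)\,k!\,l!}=E_{\alpha,\beta,\gamma}^{-n}(x,y).$$ The power $(1-t)^{-\delta}$ is principal. *)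

theory Defs
  imports "HOL-Analysis.Analysis"
begin

text \<open>The reciprocal Gamma function is the entire function \<^const>\<open>rGamma\<close>, which vanishes at the
  poles of \<^const>\<open>Gamma\<close>.\<close>

definition mittag_leffler2 ::
    "complex \<Rightarrow> complex \<Rightarrow> complex \<Rightarrow> complex \<Rightarrow> complex \<Rightarrow> complex \<Rightarrow> complex" where
  "mittag_leffler2 \<alpha> \<beta> \<gamma> \<delta> x y =
     (\<Sum>k. \<Sum>l. pochhammer \<delta> (k + l) * rGamma (\<alpha> * of_nat k + \<beta> * of_nat l + \<gamma>) *
                (x ^ k * y ^ l / (fact k * fact l)))"

definition laguerre2 ::
    "nat \<Rightarrow> complex \<Rightarrow> complex \<Rightarrow> complex \<Rightarrow> complex \<Rightarrow> complex \<Rightarrow> complex" where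
  "laguerre2 n \<alpha> \<beta> \<gamma> x y =
     (\<Sum>l=0..n. \<Sum>k=0..n-l. pochhammer (- of_nat n) (k + l) *
        rGamma (\<alpha> * of_nat k + \<beta> * of_nat l + \<gamma>) * (x ^ k * y ^ l / (fact k * fact l)))"

lemma laguerre2_eq_mittag_leffler2:
  "laguerre2 n \<alpha> \<beta> \<gamma> x y = mittag_leffler2 \<alpha> \<beta> \<gamma> (- of_nat n) x y"
proof -
  define f where "f k l = pochhammer (- of_nat n) (k + l) *
     rGamma (\<alpha> * of_nat k + \<beta> * of_nat l + \<gamma>) * (x ^ k * y ^ l / (fact k * fact l))" for k l
  have f0: "f k l = 0" if "k + l > n" for k l
    using that by (simp add: f_def pochhammer_of_nat_eq_0_lemma)
  have inner: "(\<Sum>l. f k l) = (\<Sum>l=0..n. f k l)" for k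
    by (rule suminf_finite) (auto intro: f0)
  have "mittag_leffler2 \<alpha> \<beta> \<gamma> (- of_nat n) x y = (\<Sum>k. \<Sum>l=0..n. f k l)"
    unfolding mittag_leffler2_def f_def[symmetric] inner ..
  also have "\<dots> = (\<Sum>k=0..n. \<Sum>l=0..n. f k l)"
    by (rule suminf_finite) (auto intro!: sum.neutral f0)
  also have "\<dots> = (\<Sum>l=0..n. \<Sum>k=0..n. f k l)"
    by (rule sum.swap)
  also have "\<dots> = (\<Sum>l=0..n. \<Sum>k=0..n-l. f k l)"
    by (intro sum.cong refl sum.mono_neutral_right) (auto intro!: f0)
  finally show ?thesis
    by (simp add: laguerre2_def f_def)
qed

end

theory Submission
  imports Defs
begin

text \<open>
  Write \<open>m = k + l\<close> and expand each Laguerre polynomial, which is the Mittag-Leffler series with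
  \<open>\<delta>\<close> replaced by \<open>-n\<close>. The left-hand side becomes a triple series over \<open>(n, k, l)\<close> in which \<open>n\<close>
  occurs only through \<open>(\<delta>)\<^sub>n (-n)\<^sub>m t\<^sup>n / n!\<close>. Since \<open>(-n)\<^sub>m = (-1)\<^sup>m n! / (n - m)!\<close> for
  \<open>n \<ge> m\<close> and vanishes otherwise, summing over \<open>n\<close> first shifts the binomial series to the one with
  parameter \<open>\<delta> + m\<close> and yields \<open>(1 - t)\<^sup>-\<^sup>\<delta> (\<delta>)\<^sub>m (-t / (1 - t))\<^sup>m\<close>
  (\<open>generating_series_pochhammer\<close>). The powers of \<open>-t / (1 - t)\<close> are absorbed into the arguments
  \<open>x\<close> and \<open>y\<close>, and what remains is the series on the right-hand side.

  What has to be justified is the interchange of summations. Replacing \<open>\<delta>\<close> and \<open>t\<close> by their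
  absolute values in the binomial series bounds the sum over \<open>n\<close> of the absolute values
  (\<open>generating_series_pochhammer_norm_le\<close>) by a term of a double series of Mittag-Leffler type with
  nonnegative parameters, so it is enough that this double series converges for arbitrary arguments
  (\<open>mittag_leffler2_majorant_summable\<close>). The Pochhammer symbol and the factorials contribute only a
  geometric factor in \<open>m\<close>. Hence the analytic input is that \<open>1 / \<Gamma>(\<alpha> k + \<beta> l + \<gamma>)\<close> decays faster
  than every geometric sequence in \<open>m\<close> (\<open>rGamma_lattice_bound\<close>). The points \<open>\<alpha> k + \<beta> l + \<gamma>\<close> move to
  the right at least linearly in \<open>m\<close> and leave the real axis at most linearly, so it suffices that
  \<open>1 / \<Gamma>(s)\<close> grows at most like \<open>exp (\<pi> |Im s|)\<close> in the vertical direction, while decaying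
  faster than any exponential in \<open>Re s\<close>. The former is a consequence of the reflection formula, the
  latter of the functional equation.
\<close>

section \<open>Pochhammer symbols\<close>

lemma pochhammer_nonneg_of_nonneg:
  fixes x :: real
  assumes "x \<ge> 0"
  shows "pochhammer x n \<ge> 0"
  using assms by (induction n) (auto simp: pochhammer_Suc)

lemma norm_pochhammer_le:
  fixes a :: "'a::real_normed_field"
  shows "norm (pochhammer a n) \<le> pochhammer (norm a) n"
proof (induction n)
  case (Suc n)
  have "norm (a + of_nat n) \<le> norm a + real n"
    by (metis norm_of_nat norm_triangle_ineq)
  with Suc show ?case
    by (auto simp: pochhammer_Suc norm_mult intro!: mult_mono pochhammer_nonneg_of_nonneg)
qed auto

lemma norm_pochhammer_ge:
  assumes "Re z > 0"
  shows "pochhammer (Re z) n \<le> norm (pochhammer z n)"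
proof (induction n)
  case (Suc n)
  have "Re z + real n \<le> norm (z + of_nat n)"
    using complex_Re_le_cmod[of "z + of_nat n"] by simp
  with Suc assms show ?case
    by (auto simp: pochhammer_Suc norm_mult intro!: mult_mono)
qed auto

lemma pochhammer_mono_real:
  fixes a b :: real
  assumes "0 \<le> a" "a \<le> b"
  shows "pochhammer a n \<le> pochhammer b n"
  using assms
  by (induction n) (auto simp: pochhammer_Suc intro!: mult_mono pochhammer_nonneg_of_nonneg)

lemma pochhammer_le_power_fact:
  fixes d :: real
  assumes "d \<ge> 0"
  shows "pochhammer d n \<le> (1 + d) ^ n * fact n"
proof (induction n)
  case (Suc n)
  have "d + real n \<le> (1 + d) * (1 + real n)"
    using assms by (simp add: algebra_simps)
  hence "pochhammer d n * (d + real n) \<le> ((1 + d) ^ n * fact n) * ((1 + d) * (1 + real n))"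
    using Suc assms by (intro mult_mono) (auto intro!: pochhammer_nonneg_of_nonneg)
  thus ?case by (simp add: pochhammer_Suc algebra_simps)
qed auto

lemma pochhammer_minus_of_nat_eq:
  "pochhammer (- of_nat n :: 'a::field_char_0) m =
     (if n < m then 0 else (-1) ^ m * fact n / fact (n - m))"
proof (cases "n < m")
  case True
  thus ?thesis by (simp add: pochhammer_of_nat_eq_0_lemma)
next
  case False
  have "fact n = pochhammer (1::'a) ((n - m) + m)"
    using False by (simp add: pochhammer_fact)
  also have "\<dots> = pochhammer 1 (n - m) * pochhammer (1 + of_nat (n - m)) m"
    by (rule pochhammer_product')
  also have "\<dots> = fact (n - m) * pochhammer (of_nat n - of_nat m + 1) m"
    using False by (simp add: pochhammer_fact of_nat_diff add_ac)
  finally show ?thesis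
    using False by (simp add: pochhammer_minus)
qed

section \<open>Decay of the reciprocal Gamma function in sectors\<close>

text \<open>
  This is the familiar bound \<open>|\<Gamma>(z)| \<le> \<Gamma>(Re z)\<close> in reciprocal form. It holds already for the finite
  products in the limit formula for \<open>1 / \<Gamma>\<close>, because \<open>|z + j| \<ge> Re z + j\<close>.
\<close>

lemma norm_rGamma_ge:
  assumes "Re z > 0"
  shows "rGamma (Re z) \<le> norm (rGamma z)"
proof (rule LIMSEQ_le[OF rGamma_series_LIMSEQ tendsto_norm[OF rGamma_series_LIMSEQ]])
  have "rGamma_series (Re z) n \<le> norm (rGamma_series z n)" for n
    using norm_pochhammer_ge[OF assms, of "n + 1"]
    by (auto simp: rGamma_series_def norm_divide norm_mult intro!: divide_right_mono)
  thus "\<exists>N. \<forall>n\<ge>N. rGamma_series (Re z) n \<le> norm (rGamma_series z n)" by blast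
qed

text \<open>
  The reflection formula expresses \<open>1 / \<Gamma>(s)\<close> as \<open>sin (\<pi> s) / \<pi>\<close>, which is of size at most
  \<open>exp (\<pi> |Im s|)\<close>, divided by \<open>1 / \<Gamma>(1 - s)\<close>. The functional equation moves \<open>1 - s\<close> back into the
  strip, to \<open>3 - s\<close>, where \<open>1 / \<Gamma>\<close> is bounded below. The factors \<open>1 - s\<close> and \<open>2 - s\<close> picked up on the
  way have zeros on the real axis, so the part of the strip near the axis is treated by compactness.
\<close>

lemma rGamma_strip_bound:
  "\<exists>C>0. \<forall>s. 1 \<le> Re s \<and> Re s \<le> 2 \<longrightarrow> norm (rGamma s) \<le> C * exp (pi * \<bar>Im s\<bar>)"
proof -
  have "continuous_on {1..2} (rGamma :: real \<Rightarrow> real)"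
    by (intro continuous_intros)
  then obtain \<sigma> :: real where \<sigma>: "\<sigma> \<in> {1..2}" "\<And>x. x \<in> {1..2} \<Longrightarrow> rGamma \<sigma> \<le> rGamma x"
    using continuous_attains_inf[of "{1..2::real}" rGamma] by auto
  define c where "c = rGamma \<sigma>"
  have "c > 0"
    using \<sigma>(1) by (simp add: c_def rGamma_inverse_Gamma Gamma_real_pos)
  have "compact (rGamma ` cbox (Complex 1 (-1)) (Complex 2 1))"
    by (intro compact_continuous_image continuous_intros compact_cbox)
  then obtain B where B: "B > 0"
      "\<And>s. s \<in> cbox (Complex 1 (-1)) (Complex 2 1) \<Longrightarrow> norm (rGamma s) \<le> B"
    using compact_imp_bounded bounded_pos by (metis imageI)
  have "norm (rGamma s) \<le> (B + 1 / (pi * c)) * exp (pi * \<bar>Im s\<bar>)"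
    if s: "1 \<le> Re s" "Re s \<le> 2" for s
  proof (cases "\<bar>Im s\<bar> \<le> 1")
    case True
    have "norm (rGamma s) \<le> B * 1"
      using B(2)[of s] s True by (auto simp: in_cbox_complex_iff abs_le_iff)
    also have "\<dots> \<le> (B + 1 / (pi * c)) * exp (pi * \<bar>Im s\<bar>)"
      using B(1) \<open>c > 0\<close> by (intro mult_mono) auto
    finally show ?thesis .
  next
    case False
    \<comment> \<open>Now \<open>|Im s| > 1\<close> keeps \<open>s\<close> at distance at least 1 from the zeros of \<open>(1 - s) (2 - s)\<close>.\<close>
    have "pochhammer (1 - s) 2 = (1 - s) * (2 - s)"
      by (simp add: eval_nat_numeral pochhammer_Suc algebra_simps)
    hence eq: "rGamma (1 - s) = (1 - s) * (2 - s) * rGamma (3 - s)"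
      using pochhammer_rGamma[of "1 - s" 2] by simp
    have "c \<le> rGamma (3 - Re s)"
      unfolding c_def by (rule \<sigma>(2)) (use s in auto)
    also have "\<dots> \<le> norm (rGamma (3 - s))"
      using norm_rGamma_ge[of "3 - s"] s by simp
    finally have 1: "c \<le> norm (rGamma (3 - s))" .
    have 2: "1 \<le> norm (1 - s)" "1 \<le> norm (2 - s)"
      using abs_Im_le_cmod[of "1 - s"] abs_Im_le_cmod[of "2 - s"] False by auto
    have "1 * 1 * c \<le> norm (1 - s) * norm (2 - s) * norm (rGamma (3 - s))"
      using 1 2 \<open>c > 0\<close> by (intro mult_mono) auto
    hence "c \<le> norm (rGamma (1 - s))"
      by (simp add: eq norm_mult)
    hence "norm (rGamma s) * c \<le> norm (rGamma s) * norm (rGamma (1 - s))"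
      by (intro mult_left_mono) auto
    also have "\<dots> = norm (sin (of_real pi * s)) / pi"
      unfolding norm_mult [symmetric] rGamma_reflection_complex by (simp add: norm_divide)
    also have "norm (sin (of_real pi * s)) \<le> exp \<bar>Im (of_real pi * s)\<bar>"
      using cmod_sin_le_exp[of 1 "of_real pi * s"] by simp
    also have "\<bar>Im (of_real pi * s)\<bar> = pi * \<bar>Im s\<bar>"
      by (simp add: abs_mult)
    finally have "norm (rGamma s) \<le> 1 / (pi * c) * exp (pi * \<bar>Im s\<bar>)"
      using \<open>c > 0\<close> by (simp add: field_simps)
    also have "\<dots> \<le> (B + 1 / (pi * c)) * exp (pi * \<bar>Im s\<bar>)"
      using B(1) by (intro mult_right_mono) auto
    finally show ?thesis .
  qed
  moreover have "B + 1 / (pi * c) > 0"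
    using B(1) \<open>c > 0\<close> by (intro add_pos_pos) auto
  ultimately show ?thesis by blast
qed

text \<open>
  Moving \<open>s\<close> to the left by \<open>N\<close> steps into the strip divides \<open>1 / \<Gamma>\<close> by a Pochhammer symbol of modulus
  at least \<open>N!\<close>, with \<open>N\<close> equal to \<open>Re s\<close> up to a bounded error. A factorial outgrows every exponential,
  which makes the rate \<open>q\<close> arbitrary.
\<close>

lemma rGamma_half_plane_bound:
  assumes "q \<ge> 0"
  shows "\<exists>C>0. \<forall>s. 1 \<le> Re s \<longrightarrow> norm (rGamma s) \<le> C * exp (pi * \<bar>Im s\<bar> - q * Re s)"
proof -
  obtain C where C: "C > 0"
      "\<And>s. 1 \<le> Re s \<Longrightarrow> Re s \<le> 2 \<Longrightarrow> norm (rGamma s) \<le> C * exp (pi * \<bar>Im s\<bar>)"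
    using rGamma_strip_bound by blast
  define D where "D = C * exp (exp q + 2 * q)"
  have "norm (rGamma s) \<le> D * exp (pi * \<bar>Im s\<bar> - q * Re s)" if s: "1 \<le> Re s" for s
  proof -
    \<comment> \<open>The shift by 1 places \<open>s0\<close> in the strip \<open>1 \<le> Re s0 < 2\<close>, so that \<open>|s0 + j| \<ge> 1 + j\<close>.\<close>
    define N where "N = nat (\<lfloor>Re s\<rfloor> - 1)"
    define s0 where "s0 = s - of_nat N"
    have "real N = of_int (\<lfloor>Re s\<rfloor> - 1)"
      using s by (simp add: N_def le_floor_iff)
    hence N: "1 \<le> Re s - real N" "Re s - real N \<le> 2"
      by linarith+
    have "fact N \<le> pochhammer (Re s0) N"
      unfolding pochhammer_fact using N by (intro pochhammer_mono_real) (auto simp: s0_def)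
    also have "\<dots> \<le> norm (pochhammer s0 N)"
      using N by (intro norm_pochhammer_ge) (auto simp: s0_def)
    finally have "fact N * norm (rGamma s) \<le> norm (pochhammer s0 N) * norm (rGamma s)"
      by (intro mult_right_mono) auto
    also have "\<dots> = norm (rGamma s0)"
      using pochhammer_rGamma[of s0 N] by (simp add: norm_mult s0_def)
    also have "\<dots> \<le> C * exp (pi * \<bar>Im s\<bar>)"
      using C(2)[of s0] N by (simp add: s0_def)
    finally have 1: "norm (rGamma s) \<le> C * exp (pi * \<bar>Im s\<bar>) / fact N"
      by (simp add: field_simps)
    have power_div_fact: "x ^ N / fact N \<le> exp x" if "x \<ge> 0" for x :: real
    proof -
      have "(\<Sum>n\<in>{N}. x ^ n /\<^sub>R fact n) \<le> (\<Sum>n. x ^ n /\<^sub>R fact n)"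
        using that by (intro sum_le_suminf) (auto intro: summable_exp)
      thus ?thesis
        by (simp add: exp_def field_simps)
    qed
    have "exp (q * (Re s - 2)) / fact N \<le> exp (exp q)"
    proof -
      have "exp (q * (Re s - 2)) \<le> exp q ^ N"
        using N(2) assms by (simp flip: exp_of_nat2_mult add: mult_left_mono)
      hence "exp (q * (Re s - 2)) / fact N \<le> exp q ^ N / fact N"
        by (intro divide_right_mono) auto
      also have "\<dots> \<le> exp (exp q)"
        by (rule power_div_fact) auto
      finally show ?thesis .
    qed
    hence "1 / fact N \<le> exp (exp q + 2 * q) * exp (- q * Re s)"
      by (simp add: exp_diff exp_add exp_minus field_simps)
    hence "C * exp (pi * \<bar>Im s\<bar>) * (1 / fact N) \<le>
             C * exp (pi * \<bar>Im s\<bar>) * (exp (exp q + 2 * q) * exp (- q * Re s))"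
      using C(1) by (intro mult_left_mono) auto
    also have "\<dots> = D * exp (pi * \<bar>Im s\<bar> - q * Re s)"
      by (simp add: D_def exp_diff exp_minus field_simps)
    finally show ?thesis
      using 1 by simp
  qed
  moreover have "D > 0"
    using C(1) by (simp add: D_def)
  ultimately show ?thesis by blast
qed

text \<open>
  The rate \<open>q\<close> of decay in \<open>Re s\<close> can be prescribed; it is chosen so that a decay by \<open>q a\<close> per unit of
  \<open>k + l\<close>, where \<open>a\<close> is the least speed to the right, compensates both the growth \<open>\<pi> b\<close> caused by the
  imaginary parts and the factor \<open>Q\<close>. Only finitely many points lie to the left of \<open>Re s = 1\<close>.
\<close>

lemma rGamma_lattice_bound:
  fixes \<alpha> \<beta> \<gamma> :: complex
  assumes "Re \<alpha> > 0" "Re \<beta> > 0" "Q > 0"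
  shows "\<exists>C. \<forall>k l. norm (rGamma (\<alpha> * of_nat k + \<beta> * of_nat l + \<gamma>)) * Q ^ (k + l) \<le> C"
proof -
  define s where "s k l = \<alpha> * of_nat k + \<beta> * of_nat l + \<gamma>" for k l
  define a where "a = min (Re \<alpha>) (Re \<beta>)"
  define b where "b = max \<bar>Im \<alpha>\<bar> \<bar>Im \<beta>\<bar>"
  define q where "q = (pi * b + \<bar>ln Q\<bar>) / a"
  have a: "a > 0" and b: "b \<ge> 0"
    using assms by (auto simp: a_def b_def)
  hence q: "q \<ge> 0"
    by (auto simp: q_def intro!: divide_nonneg_nonneg add_nonneg_nonneg)
  have Re_s: "Re (s k l) \<ge> a * real (k + l) + Re \<gamma>" for k l
  proof -
    have "a * real k \<le> Re \<alpha> * real k" "a * real l \<le> Re \<beta> * real l"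
      by (intro mult_right_mono; simp add: a_def)+
    thus ?thesis by (simp add: s_def algebra_simps)
  qed
  have Im_s: "\<bar>Im (s k l)\<bar> \<le> b * real (k + l) + \<bar>Im \<gamma>\<bar>" for k l
  proof -
    have "\<bar>Im \<alpha>\<bar> * real k \<le> b * real k" "\<bar>Im \<beta>\<bar> * real l \<le> b * real l"
      by (intro mult_right_mono; simp add: b_def)+
    moreover have "\<bar>Im (s k l)\<bar> \<le> \<bar>Im \<alpha>\<bar> * real k + \<bar>Im \<beta>\<bar> * real l + \<bar>Im \<gamma>\<bar>"
      using abs_triangle_ineq[of "Im \<alpha> * real k + Im \<beta> * real l" "Im \<gamma>"]
            abs_triangle_ineq[of "Im \<alpha> * real k" "Im \<beta> * real l"]
      by (simp add: s_def abs_mult)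
    ultimately show ?thesis by (simp add: algebra_simps)
  qed
  obtain C where C: "C > 0"
      "\<And>z. 1 \<le> Re z \<Longrightarrow> norm (rGamma z) \<le> C * exp (pi * \<bar>Im z\<bar> - q * Re z)"
    using rGamma_half_plane_bound[OF q] by blast
  \<comment> \<open>Points with \<open>Re s < 1\<close> satisfy \<open>k + l \<le> M\<close>.\<close>
  define M where "M = nat \<lceil>(1 - Re \<gamma>) / a\<rceil>"
  define h where "h p = norm (rGamma (s (fst p) (snd p))) * Q ^ (fst p + snd p)" for p :: "nat \<times> nat"
  define D where "D = Max (h ` ({..M} \<times> {..M}))"
  have "h (k, l) \<le> max D (C * exp (pi * \<bar>Im \<gamma>\<bar> - q * Re \<gamma>))" for k l
  proof (cases "Re (s k l) \<ge> 1")
    case True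
    have qa: "q * a = pi * b + \<bar>ln Q\<bar>"
      using a by (simp add: q_def)
    have "pi * \<bar>Im (s k l)\<bar> - q * Re (s k l) + real (k + l) * ln Q
            \<le> pi * (b * real (k + l) + \<bar>Im \<gamma>\<bar>) - q * (a * real (k + l) + Re \<gamma>)
                + real (k + l) * \<bar>ln Q\<bar>"
      using Re_s[of k l] Im_s[of k l] q
      by (intro add_mono diff_mono mult_left_mono) auto
    also have "\<dots> = pi * \<bar>Im \<gamma>\<bar> - q * Re \<gamma> + real (k + l) * (pi * b + \<bar>ln Q\<bar> - q * a)"
      by (simp add: algebra_simps)
    also have "\<dots> = pi * \<bar>Im \<gamma>\<bar> - q * Re \<gamma>"
      by (simp add: qa)
    finally have exponent:
      "pi * \<bar>Im (s k l)\<bar> - q * Re (s k l) + real (k + l) * ln Q \<le> pi * \<bar>Im \<gamma>\<bar> - q * Re \<gamma>" .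
    have "h (k, l) \<le> C * exp (pi * \<bar>Im (s k l)\<bar> - q * Re (s k l)) * exp (real (k + l) * ln Q)"
      using C(2)[OF True] assms by (simp add: h_def exp_of_nat_mult mult_right_mono del: of_nat_add)
    also have "\<dots> = C * exp (pi * \<bar>Im (s k l)\<bar> - q * Re (s k l) + real (k + l) * ln Q)"
      by (simp only: exp_add mult.assoc)
    also have "\<dots> \<le> C * exp (pi * \<bar>Im \<gamma>\<bar> - q * Re \<gamma>)"
      using exponent C(1) by (intro mult_left_mono) auto
    finally show ?thesis by simp
  next
    case False
    hence "a * real (k + l) \<le> 1 - Re \<gamma>"
      using Re_s[of k l] by linarith
    hence "real (k + l) \<le> (1 - Re \<gamma>) / a"
      using a by (simp add: field_simps)
    hence "k + l \<le> M"
      unfolding M_def by linarith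
    hence "h (k, l) \<le> D"
      unfolding D_def by (intro Max_ge) auto
    thus ?thesis by simp
  qed
  thus ?thesis
    by (auto simp: h_def s_def)
qed

section \<open>Absolute convergence of the double series\<close>

lemma summable_on_geometric_half_prod:
  "(\<lambda>(k, l). (1/2 :: real) ^ (k + l)) summable_on (UNIV :: (nat \<times> nat) set)"
proof -
  have half: "((\<lambda>k. (1/2 :: real) ^ k) has_sum 2) UNIV"
    using geometric_sums[of "1/2::real"] by (intro sums_nonneg_imp_has_sum) auto
  have "(\<lambda>(k, l). (1/2 :: real) ^ (k + l)) summable_on (Sigma UNIV (\<lambda>_. UNIV))"
  proof (rule summable_on_SigmaI)
    fix k :: nat
    show "((\<lambda>l. case (k, l) of (k, l) \<Rightarrow> (1/2 :: real) ^ (k + l)) has_sum ((1/2) ^ k * 2)) UNIV"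
      using has_sum_cmult_right[OF half, of "(1/2) ^ k"] by (simp add: power_add)
    show "(\<lambda>k. (1/2 :: real) ^ k * 2) summable_on UNIV"
      using has_sum_cmult_left[OF half, of 2] by (auto simp: summable_on_def)
  qed auto
  thus ?thesis by simp
qed

text \<open>
  Besides the values of \<open>1 / \<Gamma>\<close>, every factor is at most geometric in \<open>k + l\<close>:
  \<open>(d)\<^sub>k\<^sub>+\<^sub>l \<le> (1 + d)\<^bsup>k + l\<^esup> (k + l)!\<close> and the quotient of factorials is a binomial coefficient. With
  ratio \<open>R\<close> for their product, the lattice bound for \<open>2 R\<close> leaves a convergent geometric series.
\<close>

lemma mittag_leffler2_majorant_summable:
  fixes \<alpha> \<beta> \<gamma> :: complex and d X Y :: real
  assumes "Re \<alpha> > 0" "Re \<beta> > 0" "d \<ge> 0" "X \<ge> 0" "Y \<ge> 0"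
  shows "(\<lambda>(k, l). pochhammer d (k + l) * norm (rGamma (\<alpha> * of_nat k + \<beta> * of_nat l + \<gamma>)) *
            (X ^ k * Y ^ l / (fact k * fact l))) summable_on UNIV"
    (is "?f summable_on UNIV")
proof -
  define R where "R = (1 + d) * 2 * (1 + X + Y)"
  have "R > 0" using assms by (simp add: R_def)
  obtain C where C:
      "\<And>k l. norm (rGamma (\<alpha> * of_nat k + \<beta> * of_nat l + \<gamma>)) * (2 * R) ^ (k + l) \<le> C"
    using rGamma_lattice_bound[of \<alpha> \<beta> "2 * R" \<gamma>] assms \<open>R > 0\<close> by auto
  have bound: "norm (?f (k, l)) \<le> C * (1/2) ^ (k + l)" for k l
  proof -
    define g where "g = norm (rGamma (\<alpha> * of_nat k + \<beta> * of_nat l + \<gamma>))"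
    have fact_ratio: "(fact (k + l) :: real) / (fact k * fact l) \<le> 2 ^ (k + l)"
    proof -
      have "(fact (k + l) :: real) / (fact k * fact l) = real ((k + l) choose k)"
        by (simp add: binomial_fact)
      also have "\<dots> \<le> real (2 ^ (k + l))"
        by (intro of_nat_mono binomial_le_pow2)
      finally show ?thesis by simp
    qed
    have "X ^ k * Y ^ l \<le> (1 + X + Y) ^ k * (1 + X + Y) ^ l"
      using assms by (intro mult_mono power_mono) auto
    hence XY: "X ^ k * Y ^ l \<le> (1 + X + Y) ^ (k + l)"
      by (simp add: power_add)
    have "?f (k, l) = g * (pochhammer d (k + l) * (1 / (fact k * fact l)) * (X ^ k * Y ^ l))"
      by (simp add: g_def)
    also have "\<dots> \<le> g * (((1 + d) ^ (k + l) * fact (k + l)) * (1 / (fact k * fact l)) *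
                      (1 + X + Y) ^ (k + l))"
      using assms XY pochhammer_le_power_fact[of d "k + l"]
      by (intro mult_left_mono mult_mono mult_nonneg_nonneg) (auto simp: g_def)
    also have "\<dots> = g * ((1 + d) ^ (k + l) * (fact (k + l) / (fact k * fact l)) *
                      (1 + X + Y) ^ (k + l))"
      by simp
    also have "\<dots> \<le> g * ((1 + d) ^ (k + l) * 2 ^ (k + l) * (1 + X + Y) ^ (k + l))"
      using assms fact_ratio
      by (intro mult_left_mono mult_right_mono) (auto simp: g_def)
    also have "(1 + d) ^ (k + l) * 2 ^ (k + l) * (1 + X + Y) ^ (k + l) = R ^ (k + l)"
      by (simp only: R_def power_mult_distrib)
    also have "g * R ^ (k + l) = (g * (2 * R) ^ (k + l)) * (1/2) ^ (k + l)"
      by (simp add: power_mult_distrib power_divide)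
    also have "\<dots> \<le> C * (1/2) ^ (k + l)"
      using C[of k l] by (intro mult_right_mono) (auto simp: g_def)
    finally have "?f (k, l) \<le> C * (1/2) ^ (k + l)" .
    moreover have "?f (k, l) \<ge> 0"
      using assms by (auto intro!: mult_nonneg_nonneg divide_nonneg_nonneg pochhammer_nonneg_of_nonneg)
    ultimately show ?thesis by simp
  qed
  have "(\<lambda>p. C * (case p of (k, l) \<Rightarrow> (1/2) ^ (k + l))) summable_on (UNIV :: (nat \<times> nat) set)"
    by (intro summable_on_cmult_right summable_on_geometric_half_prod)
  hence "(\<lambda>p. norm (?f p)) summable_on UNIV"
    by (rule Infinite_Sum.abs_summable_on_comparison_test') (use bound in auto)
  thus ?thesis
    by (rule Infinite_Sum.abs_summable_summable)
qed

text \<open>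
  Absolute convergence turns the iterated sum in the definition of \<open>E\<close> into an unordered sum over pairs,
  which is the form in which sums can be interchanged.
\<close>

lemma mittag_leffler2_has_sum:
  assumes "Re \<alpha> > 0" "Re \<beta> > 0"
  shows "((\<lambda>(k, l). pochhammer \<delta> (k + l) * rGamma (\<alpha> * of_nat k + \<beta> * of_nat l + \<gamma>) *
            (x ^ k * y ^ l / (fact k * fact l))) has_sum mittag_leffler2 \<alpha> \<beta> \<gamma> \<delta> x y) UNIV"
proof -
  define f where "f k l = pochhammer \<delta> (k + l) * rGamma (\<alpha> * of_nat k + \<beta> * of_nat l + \<gamma>) *
     (x ^ k * y ^ l / (fact k * fact l))" for k l
  have "(\<lambda>p. norm (case p of (k, l) \<Rightarrow> f k l)) summable_on UNIV"
    by (rule Infinite_Sum.abs_summable_on_comparison_test'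
          [OF mittag_leffler2_majorant_summable[OF assms, of "norm \<delta>" "norm x" "norm y" \<gamma>]])
       (auto simp: f_def norm_mult norm_divide norm_power
             intro!: mult_right_mono divide_right_mono norm_pochhammer_le)
  hence summable: "(\<lambda>(k, l). f k l) summable_on UNIV"
    by (rule Infinite_Sum.abs_summable_summable)
  hence summable': "(\<lambda>(k, l). f k l) summable_on Sigma UNIV (\<lambda>_. UNIV)"
    by simp
  have inner: "(f k has_sum (\<Sum>l. f k l)) UNIV" for k
    using summable_on_SigmaD1[OF summable', of k]
    by (metis UNIV_I has_sum_imp_sums has_sum_infsum sums_unique)
  obtain S where S: "((\<lambda>(k, l). f k l) has_sum S) UNIV"
    using summable by (auto simp: summable_on_def)
  hence S': "((\<lambda>(k, l). f k l) has_sum S) (Sigma UNIV (\<lambda>_. UNIV))"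
    by simp
  have "((\<lambda>k. \<Sum>l. f k l) has_sum S) UNIV"
    by (rule has_sum_SigmaD[OF S']) (use inner in simp)
  hence "S = (\<Sum>k. \<Sum>l. f k l)"
    by (intro sums_unique has_sum_imp_sums)
  with S show ?thesis
    by (simp add: mittag_leffler2_def f_def)
qed

section \<open>Differentiated binomial series\<close>

lemma binomial_series_has_sum_real:
  fixes d r :: real
  assumes "0 \<le> r" "r < 1" "0 \<le> d"
  shows "((\<lambda>j. pochhammer d j / fact j * r ^ j) has_sum (1 - r) powr (-d)) UNIV"
proof (rule sums_nonneg_imp_has_sum)
  have "((-d) gchoose j) * (-r) ^ j = pochhammer d j / fact j * r ^ j" for j
    by (simp add: gbinomial_pochhammer power_minus[of r])
  thus "(\<lambda>j. pochhammer d j / fact j * r ^ j) sums (1 - r) powr (-d)"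
    using gen_binomial_real[of "-r" "-d"] assms by simp
  show "pochhammer d j / fact j * r ^ j \<ge> 0" for j
    using assms by (auto intro!: mult_nonneg_nonneg divide_nonneg_nonneg pochhammer_nonneg_of_nonneg)
qed

lemma binomial_series_has_sum_complex:
  fixes a t :: complex
  assumes "norm t < 1"
  shows "((\<lambda>j. pochhammer a j / fact j * t ^ j) has_sum (1 - t) powr (-a)) UNIV"
proof (rule norm_summable_imp_has_sum)
  have "((-a) gchoose j) * (-t) ^ j = pochhammer a j / fact j * t ^ j" for j
    by (simp add: gbinomial_pochhammer power_minus[of t])
  thus "(\<lambda>j. pochhammer a j / fact j * t ^ j) sums (1 - t) powr (-a)"
    using gen_binomial_complex[of "-t" "-a"] assms by simp
  have "summable (\<lambda>j. pochhammer (norm a) j / fact j * norm t ^ j)"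
    using binomial_series_has_sum_real[of "norm t" "norm a"] assms
    by (auto dest: has_sum_imp_sums simp: sums_iff)
  thus "summable (\<lambda>j. norm (pochhammer a j / fact j * t ^ j))"
    by (rule summable_comparison_test')
       (auto simp: norm_mult norm_divide norm_power
             intro!: mult_right_mono divide_right_mono norm_pochhammer_le)
qed

text \<open>
  The summand is \<open>z\<^sup>m\<close> times the \<open>m\<close>-th derivative of the binomial series, term by term. The series is
  again a binomial series because \<open>(a)\<^sub>m\<^sub>+\<^sub>j = (a)\<^sub>m (a + m)\<^sub>j\<close>. The sum \<open>S\<close> is left abstract
  so that the real majorant and the complex series are both instances.
\<close>

lemma has_sum_differentiated_binomial:
  fixes a z S :: "'a::{real_normed_field, banach}"
  assumes "((\<lambda>j. pochhammer (a + of_nat m) j / fact j * z ^ j) has_sum S) UNIV"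
  shows "((\<lambda>n. if n < m then 0 else pochhammer a n / fact (n - m) * z ^ n)
            has_sum (pochhammer a m * z ^ m * S)) UNIV"
    (is "(?f has_sum ?S) UNIV")
proof -
  have "bij_betw (\<lambda>j. m + j) UNIV {m..}"
    by (rule bij_betwI[of _ _ _ "\<lambda>n. n - m"]) auto
  moreover have "((\<lambda>j. ?f (m + j)) has_sum ?S) UNIV"
    using has_sum_cmult_right[OF assms, of "pochhammer a m * z ^ m"]
    by (simp add: pochhammer_product' power_add mult_ac)
  ultimately have "(?f has_sum ?S) {m..}"
    using has_sum_reindex_bij_betw[of "\<lambda>j. m + j" UNIV "{m..}" ?f] by simp
  thus ?thesis
    by (rule has_sum_cong_neutral[THEN iffD1, rotated -1]) auto
qed

text \<open>
  This is where the right-hand side of the generating function comes from: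
  each \<open>(-n)\<^sub>m\<close> in a Laguerre polynomial turns into \<open>(\<delta>)\<^sub>m\<close> and a power of \<open>-t / (1 - t)\<close>.
\<close>

lemma generating_series_pochhammer:
  fixes \<delta> t :: complex
  assumes "norm t < 1"
  shows "((\<lambda>n. pochhammer \<delta> n / fact n * pochhammer (- of_nat n) m * t ^ n)
            has_sum ((1 - t) powr (-\<delta>) * pochhammer \<delta> m * (- t / (1 - t)) ^ m)) UNIV"
proof -
  have "((\<lambda>n. (-1) ^ m * (if n < m then 0 else pochhammer \<delta> n / fact (n - m) * t ^ n))
          has_sum ((-1) ^ m * (pochhammer \<delta> m * t ^ m * (1 - t) powr (- (\<delta> + of_nat m))))) UNIV"
    by (intro has_sum_cmult_right has_sum_differentiated_binomial
              binomial_series_has_sum_complex assms)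
  also have "(\<lambda>n. (-1) ^ m * (if n < m then 0 else pochhammer \<delta> n / fact (n - m) * t ^ n)) =
             (\<lambda>n. pochhammer \<delta> n / fact n * pochhammer (- of_nat n) m * t ^ n)"
    by (auto simp: pochhammer_minus_of_nat_eq fun_eq_iff)
  also have "(-1) ^ m * (pochhammer \<delta> m * t ^ m * (1 - t) powr (- (\<delta> + of_nat m))) =
             (1 - t) powr (-\<delta>) * pochhammer \<delta> m * (- t / (1 - t)) ^ m"
  proof -
    have "1 - t \<noteq> 0" using assms by auto
    hence "(1 - t) powr (- (\<delta> + of_nat m)) = (1 - t) powr (-\<delta>) / (1 - t) ^ m"
      by (simp add: powr_diff powr_nat')
    moreover have "(- t / (1 - t)) ^ m = (-1) ^ m * t ^ m / (1 - t) ^ m"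
      by (simp only: power_divide power_minus[of t])
    ultimately show ?thesis
      by (simp only: mult_ac times_divide_eq_right times_divide_eq_left)
  qed
  finally show ?thesis .
qed

text \<open>
  The sum of absolute values has the same shape as the sum itself, with \<open>|\<delta>|\<close> and \<open>|t|\<close> as parameters.
  Hence it is controlled by a Mittag-Leffler series at the arguments rescaled by \<open>|t| / (1 - |t|)\<close>.
\<close>

lemma generating_series_pochhammer_norm_le:
  fixes \<delta> t :: complex
  assumes "norm t < 1"
  defines "d \<equiv> norm \<delta>" and "r \<equiv> norm t"
  defines "f \<equiv> (\<lambda>m n. pochhammer \<delta> n / fact n * pochhammer (- of_nat n) m * t ^ n)"
  shows "(\<lambda>n. norm (f m n)) summable_on UNIV"
    and "(\<Sum>\<^sub>\<infinity>n. norm (f m n)) \<le> (1 - r) powr (-d) * pochhammer d m * (r / (1 - r)) ^ m"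
proof -
  define u where "u n = (if n < m then 0 else pochhammer d n / fact (n - m) * r ^ n)" for n
  have r: "0 \<le> r" "r < 1" and d: "0 \<le> d"
    using assms by (auto simp: r_def d_def)
  have u: "(u has_sum (pochhammer d m * r ^ m * (1 - r) powr (- (d + of_nat m)))) UNIV"
    unfolding u_def
    by (intro has_sum_differentiated_binomial binomial_series_has_sum_real)
       (use r d in auto)
  have le: "norm (f m n) \<le> u n" for n
    by (auto simp: f_def u_def pochhammer_minus_of_nat_eq norm_mult norm_divide norm_power
                   d_def r_def intro!: mult_right_mono divide_right_mono norm_pochhammer_le)
  show summable: "(\<lambda>n. norm (f m n)) summable_on UNIV"
    by (rule Infinite_Sum.abs_summable_on_comparison_test'[of u]) (use u le in \<open>auto simp: summable_on_def\<close>)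
  have "(\<Sum>\<^sub>\<infinity>n. norm (f m n)) \<le> pochhammer d m * r ^ m * (1 - r) powr (- (d + of_nat m))"
    by (rule has_sum_mono[OF has_sum_infsum[OF summable] u]) (use le in auto)
  also have "(1 - r) powr (- (d + of_nat m)) = (1 - r) powr (-d) / (1 - r) ^ m"
    using r by (simp add: powr_diff powr_realpow)
  finally show "(\<Sum>\<^sub>\<infinity>n. norm (f m n)) \<le> (1 - r) powr (-d) * pochhammer d m * (r / (1 - r)) ^ m"
    by (simp add: power_divide mult_ac)
qed

section \<open>The generating function\<close>

theorem theorem2p9:
  fixes \<alpha> \<beta> \<gamma> \<delta> x y t :: complex
  assumes "Re \<alpha> > 0" and "Re \<beta> > 0" and "norm t < 1"
  shows "(\<lambda>n. pochhammer \<delta> n / fact n * laguerre2 n \<alpha> \<beta> \<gamma> x y * t ^ n) sums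
           ((1 - t) powr (- \<delta>) *
            mittag_leffler2 \<alpha> \<beta> \<gamma> \<delta> (- (x * t) / (1 - t)) (- (y * t) / (1 - t)))"
proof -
  define c where "c = (\<lambda>(k, l). rGamma (\<alpha> * of_nat k + \<beta> * of_nat l + \<gamma>) *
                         (x ^ k * y ^ l / (fact k * fact l)))"
  define w where "w m n = pochhammer \<delta> n / fact n * pochhammer (- of_nat n) m * t ^ n" for m n
  define F where "F = (\<lambda>((k, l), n). w (k + l) n * c (k, l))"
  define d where "d = norm \<delta>"
  define r where "r = norm t"
  have r: "0 \<le> r" "r < 1" and d: "0 \<le> d"
    using assms by (auto simp: r_def d_def)
  let ?S = "(1 - t) powr (- \<delta>) *
            mittag_leffler2 \<alpha> \<beta> \<gamma> \<delta> (- (x * t) / (1 - t)) (- (y * t) / (1 - t))"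

  have sum_over_n: "((\<lambda>n. F (p, n)) has_sum
      (case p of (k, l) \<Rightarrow> (1 - t) powr (- \<delta>) *
         (pochhammer \<delta> (k + l) * rGamma (\<alpha> * of_nat k + \<beta> * of_nat l + \<gamma>) *
            ((- (x * t) / (1 - t)) ^ k * (- (y * t) / (1 - t)) ^ l / (fact k * fact l))))) UNIV" for p
  proof (cases p)
    case (Pair k l)
    have "- (x * t) / (1 - t) = x * (- t / (1 - t))" "- (y * t) / (1 - t) = y * (- t / (1 - t))"
      by simp_all
    thus ?thesis
      using has_sum_cmult_left[OF generating_series_pochhammer[OF assms(3), of \<delta> "k + l"], of "c (k, l)"]
      by (simp only: Pair F_def w_def c_def prod.case power_mult_distrib power_add)
         (simp only: mult_ac times_divide_eq_right times_divide_eq_left)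
  qed

  \<comment> \<open>Tonelli: with the absolute values summed over \<open>n\<close> first, a convergent double series remains.\<close>
  have F_summable: "F summable_on Sigma UNIV (\<lambda>_. UNIV)"
  proof (rule Infinite_Sum.abs_summable_summable, subst Infinite_Sum.abs_summable_on_Sigma_iff, intro conjI ballI)
    fix p :: "nat \<times> nat"
    show "(\<lambda>n. norm (F (p, n))) summable_on UNIV"
      using summable_on_cmult_left[OF generating_series_pochhammer_norm_le(1)[OF assms(3), of \<delta> "fst p + snd p"],
              of "norm (c p)"]
      by (simp add: F_def w_def norm_mult norm_divide case_prod_unfold)
  next
    have "norm (\<Sum>\<^sub>\<infinity>n. norm (F (p, n))) \<le>
        (1 - r) powr (-d) * (case p of (k, l) \<Rightarrow> pochhammer d (k + l) *
           norm (rGamma (\<alpha> * of_nat k + \<beta> * of_nat l + \<gamma>)) *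
             ((norm x * (r / (1 - r))) ^ k * (norm y * (r / (1 - r))) ^ l / (fact k * fact l)))"
      for p
    proof (cases p)
      case (Pair k l)
      have "norm (\<Sum>\<^sub>\<infinity>n. norm (F (p, n))) = (\<Sum>\<^sub>\<infinity>n. norm (w (k + l) n)) * norm (c (k, l))"
        by (simp add: Pair F_def norm_mult infsum_cmult_left' infsum_nonneg)
      also have "\<dots> \<le> ((1 - r) powr (-d) * pochhammer d (k + l) * (r / (1 - r)) ^ (k + l)) * norm (c (k, l))"
        using generating_series_pochhammer_norm_le(2)[OF assms(3), of \<delta> "k + l"]
        by (intro mult_right_mono) (auto simp: w_def r_def d_def)
      also have "\<dots> = (1 - r) powr (-d) * (pochhammer d (k + l) *
           norm (rGamma (\<alpha> * of_nat k + \<beta> * of_nat l + \<gamma>)) *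
             ((norm x * (r / (1 - r))) ^ k * (norm y * (r / (1 - r))) ^ l / (fact k * fact l)))"
        unfolding c_def prod.case norm_mult norm_divide norm_power norm_fact power_mult_distrib power_add
        by (simp only: mult_ac times_divide_eq_right times_divide_eq_left)
      finally show ?thesis by (simp add: Pair)
    qed
    moreover have "(\<lambda>p. (1 - r) powr (-d) * (case p of (k, l) \<Rightarrow> pochhammer d (k + l) *
           norm (rGamma (\<alpha> * of_nat k + \<beta> * of_nat l + \<gamma>)) *
             ((norm x * (r / (1 - r))) ^ k * (norm y * (r / (1 - r))) ^ l / (fact k * fact l))))
        summable_on UNIV"
      using r d assms by (intro summable_on_cmult_right mittag_leffler2_majorant_summable) auto
    ultimately show "(\<lambda>p. norm (\<Sum>\<^sub>\<infinity>n. norm (F (p, n)))) summable_on UNIV"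
      by (intro Infinite_Sum.abs_summable_on_comparison_test') auto
  qed
  have iterated_sum: "((\<lambda>p. case p of (k, l) \<Rightarrow> (1 - t) powr (- \<delta>) *
         (pochhammer \<delta> (k + l) * rGamma (\<alpha> * of_nat k + \<beta> * of_nat l + \<gamma>) *
            ((- (x * t) / (1 - t)) ^ k * (- (y * t) / (1 - t)) ^ l / (fact k * fact l))))
        has_sum ?S) UNIV"
    using has_sum_cmult_right[OF mittag_leffler2_has_sum[OF assms(1,2)], of "(1 - t) powr (- \<delta>)"]
    by (simp add: case_prod_unfold)
  have "(F has_sum ?S) (UNIV \<times> UNIV)"
    by (rule has_sum_SigmaI[OF sum_over_n iterated_sum F_summable])
  hence swapped: "((\<lambda>(n, p). F (p, n)) has_sum ?S) (Sigma UNIV (\<lambda>_. UNIV))"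
    by (subst (asm) has_sum_swap) simp

  have sum_over_p: "((\<lambda>p. F (p, n)) has_sum
      (pochhammer \<delta> n / fact n * laguerre2 n \<alpha> \<beta> \<gamma> x y * t ^ n)) UNIV" for n
  proof -
    have "((\<lambda>p. (pochhammer \<delta> n / fact n * t ^ n) *
             (case p of (k, l) \<Rightarrow> pochhammer (- of_nat n) (k + l) *
                rGamma (\<alpha> * of_nat k + \<beta> * of_nat l + \<gamma>) * (x ^ k * y ^ l / (fact k * fact l))))
           has_sum (pochhammer \<delta> n / fact n * t ^ n) * laguerre2 n \<alpha> \<beta> \<gamma> x y) UNIV"
      unfolding laguerre2_eq_mittag_leffler2
      by (intro has_sum_cmult_right mittag_leffler2_has_sum assms)
    thus ?thesis
      by (simp add: F_def w_def c_def case_prod_unfold mult_ac)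
  qed
  have "((\<lambda>n. pochhammer \<delta> n / fact n * laguerre2 n \<alpha> \<beta> \<gamma> x y * t ^ n) has_sum ?S) UNIV"
    by (rule has_sum_SigmaD[OF swapped]) (use sum_over_p in simp)
  thus ?thesis
    by (rule has_sum_imp_sums)
qed

end
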